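(* Let $\alpha,\kappa>-1$ be real numbers, let $n$ be a positive integer, and let $A_n,B_n\in\mathbb{R}^{n\times n}$ be the banded matrices built from the coefficients $a_i,b_i,c_i,d_i,e_i,f_i$ as defined in the context. Then the matrix $B_n$ is nonsingular and $$B_n^{-1}=D_n^{-1}M_n,$$ where $D_n=\mathrm{diag}(1,2,\ldots,n)$ and $M_n$ is the $n\times n$ lower triangular matrix all of whose entries on and below the main diagonal are equal to $1$ (and whose entries above the diagonal are $0$). Moreover, $$X_n=B_n^{-1}A_n=\begin{bmatrix} \hat v_0 & \hat a_0 & & & \\ \hat v_1 & \hat b_1 & \hat a_1 & & \\ \hat v_2 & \hat c_2 & \ddots & \ddots & \\ \vdots & & \ddots & \hat b_{n-2} & \hat a_{n-2}\\ \hat v_{n-1} & & & \hat c_{n-1} & \hat b_{n-1} \end{bmatrix},$$ that is, $X_n$ has first column $(\hat v_0,\hat v_1,\ldots,\hat v_{n-1})^T$, diagonal entries $(X_n)_{i,i}=\hat b_{i-1}$ for $i=2,\ldots,n$, superdiagonal entries $(X_n)_{i-1,i}=\hat a_{i-2}$ for $i=2,\ldots,n$, subdiagonal entries $(X_n)_{i+1,i}=\hat c_i$ for $i=2,\ldots,n-1$, and all other entries equal to zero, with $$\hat a_{i-2}=-\frac{(i-1+\alpha)(i-1+\kappa)}{i-1},\quad i=2,3,\ldots,n,$$ $$\hat b_{i-1}=2i-1+\alpha+\kappa,\quad i=2,3,\ldots,n,$$ $$\hat c_i=-i,\quad i=2,3,\ldots,n-1,$$ $$\hat v_0=(\alpha+1)(\kappa+1),\qquad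 \hat v_1=\frac{\alpha\kappa}{2}-1,\qquad \hat v_i=\frac{\alpha\kappa}{i+1},\quad i=2,3,\ldots,n-1.$$
   Context: For real parameters $\alpha,\kappa>-1$ and integers $i\ge 0$ define $$a_i=-(i+\alpha+1)(i+\kappa+1),\qquad b_i=i(2i+\alpha+\kappa+1)+(i+\alpha+1)(i+\kappa+1),$$ $$c_i=-i(3i+\alpha+\kappa),\qquad d_i=(i-1)i,\qquad e_i=i+1,\qquad f_i=-i.$$ (These are the coefficients of the four-term recurrence $x(e_i\mathfrak{L}_i(x)+f_i\mathfrak{L}_{i-1}(x))=a_i\mathfrak{L}_{i+1}(x)+b_i\mathfrak{L}_i(x)+c_i\mathfrak{L}_{i-1}(x)+d_i\mathfrak{L}_{i-2}(x)$ satisfied by the hypergeometric polynomials $\mathfrak{L}_n(x)={}_2F_2(-n,1;\alpha+1,\kappa+1;x)$.) The $n\times n$ matrices $A_n$ and $B_n$ are (blank entries are zero) $$A_n=\begin{bmatrix} b_0 & a_0 & & & \\ c_1 & b_1 & a_1 & & \\ d_2 & c_2 & \ddots & \ddots & \\ & \ddots & \ddots & b_{n-2} & a_{n-2}\\ & & d_{n-1} & c_{n-1} & b_{n-1} \end{bmatrix},\qquad B_n=\begin{bmatrix} e_0 & & & & \\ f_1 & e_1 & & & \\ & \ddots & \ddots & & \\ & & f_{n-2} & e_{n-2} & \\ & & & f_{n-1} & e_{n-1} \end{bmatrix}.$$ With 1-based row and column indices: $(A_n)_{i+1,i+1}=b_i$, $(A_n)_{i+1,i+2}=a_i$, $(A_n)_{i+1,i}=c_i$,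 $(A_n)_{i+1,i-1}=d_i$, and $(B_n)_{i+1,i+1}=e_i$, $(B_n)_{i+1,i}=f_i$, whenever the indices lie in $\{1,\ldots,n\}$; all other entries are zero. For small $n$, entries whose indices are out of range are simply absent. *)

theory Defs
  imports Complex_Main "Jordan_Normal_Form.Matrix" "Jordan_Normal_Form.Gauss_Jordan_Elimination"
begin

definition coef_a :: "real \<Rightarrow> real \<Rightarrow> nat \<Rightarrow> real" where
  "coef_a \<alpha> \<kappa> i = - ((real i + \<alpha> + 1) * (real i + \<kappa> + 1))"

definition coef_b :: "real \<Rightarrow> real \<Rightarrow> nat \<Rightarrow> real" where
  "coef_b \<alpha> \<kappa> i =
     real i * (2 * real i + \<alpha> + \<kappa> + 1) + (real i + \<alpha> + 1) * (real i + \<kappa> + 1)"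

definition coef_c :: "real \<Rightarrow> real \<Rightarrow> nat \<Rightarrow> real" where
  "coef_c \<alpha> \<kappa> i = - (real i * (3 * real i + \<alpha> + \<kappa>))"

definition coef_d :: "nat \<Rightarrow> real" where
  "coef_d i = (real i - 1) * real i"

definition coef_e :: "nat \<Rightarrow> real" where
  "coef_e i = real i + 1"

definition coef_f :: "nat \<Rightarrow> real" where
  "coef_f i = - real i"

(* Matrix positions are 0-based: (r, s) is the mathematical position (r + 1, s + 1), so the
   coefficients in row r carry the index r. *)

definition A_mat :: "real \<Rightarrow> real \<Rightarrow> nat \<Rightarrow> real mat" where
  "A_mat \<alpha> \<kappa> n = mat n n (\<lambda>(r, s).
     if s = r then coef_b \<alpha> \<kappa> r
     else if s = r + 1 then coef_a \<alpha> \<kappa> r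
     else if r = s + 1 then coef_c \<alpha> \<kappa> r
     else if r = s + 2 then coef_d r
     else 0)"

definition B_mat :: "nat \<Rightarrow> real mat" where
  "B_mat n = mat n n (\<lambda>(r, s).
     if s = r then coef_e r
     else if r = s + 1 then coef_f r
     else 0)"

definition D_mat :: "nat \<Rightarrow> real mat" where
  "D_mat n = mat_diag n (\<lambda>r. real (r + 1))"

definition M_mat :: "nat \<Rightarrow> real mat" where
  "M_mat n = mat n n (\<lambda>(r, s). if s \<le> r then 1 else 0)"

(* The inverse of an invertible square matrix; meaningless for other arguments. *)
definition mat_inv :: "real mat \<Rightarrow> real mat" where
  "mat_inv A = the (mat_inverse A)"

definition X_mat :: "real \<Rightarrow> real \<Rightarrow> nat \<Rightarrow> real mat" where
  "X_mat \<alpha> \<kappa> n = mat_inv (B_mat n) * A_mat \<alpha> \<kappa> n"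

end

theory Submission
  imports Defs "Jordan_Normal_Form.Determinant"
begin

text \<open>
  The matrix \<^term>\<open>B_mat n\<close> sends a vector \<open>v\<close> to the vector with entries
  \<open>(r + 1) * v r - r * v (r - 1)\<close>: it is the difference of consecutive entries of the scaled vector
  \<open>D v\<close>. Summation undoes differences, and this is why \<open>M B = D\<close> and \<open>B\<inverse> = D\<inverse> M\<close>.

  Consequently the entry \<open>(r, s)\<close> of \<open>B\<inverse> A\<close> is the sum of the first \<open>r + 1\<close> entries in column \<open>s\<close>
  of \<open>A\<close>, divided by \<open>r + 1\<close>. Such a column holds \<open>a\<close>, \<open>b\<close>, \<open>c\<close>, \<open>d\<close> with respective indices
  \<open>s - 1\<close>, \<open>s\<close>, \<open>s + 1\<close>, \<open>s + 2\<close>, and everything rests on the fact that these four numbers add up to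
  zero: hence the sums vanish from row \<open>s + 2\<close> on and the quotient loses the lowest band of \<open>A\<close>.
  Column \<open>0\<close> is the exception because it has no room for the entry
  \<open>a\<^bsub>-1\<^esub> = - \<alpha> * \<kappa>\<close>. Its sums end at \<open>\<alpha> * \<kappa>\<close> instead of zero, which fills the whole first column.

  The sums themselves never have to be evaluated: once the quotient \<open>R\<close> is written down, \<open>B R = A\<close>
  is an identity between neighbouring rows (\<open>B_mat_times_entry\<close>, \<open>reduced_entry_difference\<close>), and
  multiplication by \<open>B\<inverse>\<close> gives \<open>R = B\<inverse> A\<close> (\<open>X_mat_eq\<close>).
\<close>

text \<open>
  Inverses are unique, so exhibiting a right inverse identifies the result of Gauss-Jordan
  elimination without running it.
\<close>
lemma mat_inv_eq:
  assumes A: "A \<in> carrier_mat n n" and B: "B \<in> carrier_mat n n" and AB: "A * B = 1\<^sub>m n"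
  shows "mat_inv A = B"
proof -
  have BA: "B * A = 1\<^sub>m n"
    by (rule mat_mult_left_right_inverse[OF A B AB])
  have "A \<in> Units (ring_mat TYPE(real) n ())"
    using A B AB BA by (auto simp: Units_def ring_mat_def)
  then obtain C where C: "mat_inverse A = Some C"
    using mat_inverse(1)[OF A, where b = "()"] by blast
  then have CA: "C * A = 1\<^sub>m n" and Cn: "C \<in> carrier_mat n n"
    using mat_inverse(2)[OF A C] by auto
  have "C = C * (A * B)"
    using AB Cn by simp
  also have "\<dots> = B"
    using assoc_mult_mat[OF Cn A B] CA B by simp
  finally show ?thesis
    by (simp add: mat_inv_def C)
qed

lemma invertible_mat_of_right_inverse:
  assumes A: "A \<in> carrier_mat n n" and B: "B \<in> carrier_mat n n" and AB: "A * B = 1\<^sub>m n"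
  shows "invertible_mat (A :: real mat)"
  using A B AB mat_mult_left_right_inverse[OF A B AB]
  by (auto simp: invertible_mat_def inverts_mat_def)

lemma D_mat_right_inverse: "D_mat n * mat_diag n (\<lambda>r. 1 / real (r + 1)) = 1\<^sub>m n"
  unfolding D_mat_def mat_diag_diag by (auto simp: mat_diag_def)

lemma mat_inv_D_mat: "mat_inv (D_mat n) = mat_diag n (\<lambda>r. 1 / real (r + 1))"
  by (rule mat_inv_eq[OF _ _ D_mat_right_inverse]) (simp_all add: D_mat_def)

lemma mat_inv_D_mat_times_M_mat:
  "mat_inv (D_mat n) * M_mat n
     = mat n n (\<lambda>(r, s). if s \<le> r then 1 / real (r + 1) else 0)"
  unfolding mat_inv_D_mat
  by (subst mat_diag_mult_left[where nr = n]) (auto simp: M_mat_def)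

text \<open>
  A matrix with bidiagonal rows acts on columns as a first-order difference, so a product with
  \<^term>\<open>B_mat n\<close> can be read off entrywise. In row \<open>0\<close> the factor \<open>real r\<close> removes the
  reference to a previous row, for which \<open>r - 1\<close> would be meaningless.
\<close>
lemma B_mat_times_entry:
  assumes C: "C \<in> carrier_mat n n" and r: "r < n" and s: "s < n"
  shows "(B_mat n * C) $$ (r, s) = real (r + 1) * C $$ (r, s) - real r * C $$ (r - 1, s)"
proof -
  have "(B_mat n * C) $$ (r, s)
      = (\<Sum>k = 0..<n. (if k = r then coef_e r else if r = k + 1 then coef_f r else 0) * C $$ (k, s))"
    using C r s by (simp add: B_mat_def scalar_prod_def)
  also have "\<dots> = (\<Sum>k = 0..<n. (if k = r then coef_e r * C $$ (r, s) else 0)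
      + (if k = r - 1 then coef_f r * C $$ (r - 1, s) else 0))"
    by (rule sum.cong) (auto simp: coef_f_def)
  also have "\<dots> = coef_e r * C $$ (r, s) + coef_f r * C $$ (r - 1, s)"
    using r by (simp add: sum.distrib)
  finally show ?thesis
    by (simp add: coef_e_def coef_f_def algebra_simps)
qed

lemma B_mat_right_inverse: "B_mat n * (mat_inv (D_mat n) * M_mat n) = 1\<^sub>m n"
proof (rule eq_matI)
  fix r s assume "r < dim_row (1\<^sub>m n :: real mat)" "s < dim_col (1\<^sub>m n :: real mat)"
  then have "r < n" "s < n" by simp_all
  then show "(B_mat n * (mat_inv (D_mat n) * M_mat n)) $$ (r, s) = 1\<^sub>m n $$ (r, s)"
    unfolding mat_inv_D_mat_times_M_mat
    by (cases r) (auto simp: B_mat_times_entry)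
qed (simp_all add: B_mat_def mat_inv_D_mat_times_M_mat)

lemma mat_inv_B_mat: "mat_inv (B_mat n) = mat_inv (D_mat n) * M_mat n"
  by (rule mat_inv_eq[OF _ _ B_mat_right_inverse])
    (simp_all add: B_mat_def mat_inv_D_mat_times_M_mat)

definition reduced_entry :: "real \<Rightarrow> real \<Rightarrow> nat \<Rightarrow> nat \<Rightarrow> real" where
  "reduced_entry \<alpha> \<kappa> r s =
     (if s = 0 then
        if r = 0 then (\<alpha> + 1) * (\<kappa> + 1)
        else if r = 1 then \<alpha> * \<kappa> / 2 - 1
        else \<alpha> * \<kappa> / (real r + 1)
      else if s = r + 1 then - ((real s + \<alpha>) * (real s + \<kappa>) / real s)
      else if s = r then 2 * real s + 1 + \<alpha> + \<kappa>
      else if r = s + 1 then - real r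
      else 0)"

text \<open>
  Times \<open>r + 1\<close>, the entry in row \<open>r\<close> is a partial column sum of the recurrence matrix, so
  consecutive rows differ by one entry of that matrix. For \<open>s > 0\<close> the decisive cancellations are
  \<open>a\<^bsub>s-1\<^esub> + b\<^bsub>s\<^esub> = (s + 1) (2 s + 1 + \<alpha> + \<kappa>)\<close>, which is divisible by the row number, and
  \<open>a\<^bsub>s-1\<^esub> + b\<^bsub>s\<^esub> + c\<^bsub>s+1\<^esub> = - d\<^bsub>s+2\<^esub>\<close>;
  for \<open>s = 0\<close> it is \<open>b\<^bsub>0\<^esub> + c\<^bsub>1\<^esub> + d\<^bsub>2\<^esub> = \<alpha> * \<kappa>\<close>.
\<close>
lemma reduced_entry_difference:
  assumes "r < n" "s < n"
  shows "real (r + 1) * reduced_entry \<alpha> \<kappa> r s - real r * reduced_entry \<alpha> \<kappa> (r - 1) s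
    = A_mat \<alpha> \<kappa> n $$ (r, s)"
proof -
  have entry: "A_mat \<alpha> \<kappa> n $$ (r, s) =
      (if s = r then coef_b \<alpha> \<kappa> r else if s = r + 1 then coef_a \<alpha> \<kappa> r
       else if r = s + 1 then coef_c \<alpha> \<kappa> r else if r = s + 2 then coef_d r else 0)"
    using assms by (simp add: A_mat_def)
  note coefs = reduced_entry_def coef_a_def coef_b_def coef_c_def coef_d_def
  consider "s = r" | "s = r + 1" | "r = s + 1" | "r = s + 2" | "s > r + 1" | "r > s + 2"
    by linarith
  then show ?thesis
  proof cases
    case 1
    then show ?thesis unfolding entry by (cases r) (auto simp: coefs field_simps)
  next
    case 2
    then show ?thesis unfolding entry by (cases r) (auto simp: coefs field_simps)
  next
    case 3
    then show ?thesis unfolding entry by (cases s) (auto simp: coefs field_simps)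
  next
    case 4
    then show ?thesis unfolding entry by (cases s) (auto simp: coefs field_simps)
  next
    case 5
    then show ?thesis unfolding entry by (cases r) (simp_all add: coefs)
  next
    case 6
    have "real (r + 1) \<noteq> 0" by simp
    with 6 show ?thesis unfolding entry by (auto simp: coefs of_nat_diff add.commute)
  qed
qed

lemma B_mat_times_reduced:
  "B_mat n * mat n n (\<lambda>(r, s). reduced_entry \<alpha> \<kappa> r s) = A_mat \<alpha> \<kappa> n"
proof (rule eq_matI)
  fix r s assume "r < dim_row (A_mat \<alpha> \<kappa> n)" "s < dim_col (A_mat \<alpha> \<kappa> n)"
  then have "r < n" "s < n" by (simp_all add: A_mat_def)
  then show "(B_mat n * mat n n (\<lambda>(r, s). reduced_entry \<alpha> \<kappa> r s)) $$ (r, s)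
      = A_mat \<alpha> \<kappa> n $$ (r, s)"
    by (simp add: B_mat_times_entry flip: reduced_entry_difference)
qed (simp_all add: B_mat_def A_mat_def)

lemma X_mat_eq: "X_mat \<alpha> \<kappa> n = mat n n (\<lambda>(r, s). reduced_entry \<alpha> \<kappa> r s)"
proof -
  let ?R = "mat n n (\<lambda>(r, s). reduced_entry \<alpha> \<kappa> r s)"
  have B: "B_mat n \<in> carrier_mat n n" and I: "mat_inv (B_mat n) \<in> carrier_mat n n"
    by (simp add: B_mat_def, simp add: mat_inv_B_mat mat_inv_D_mat_times_M_mat)
  have "mat_inv (B_mat n) * B_mat n = 1\<^sub>m n"
    using mat_mult_left_right_inverse[OF B I] B_mat_right_inverse by (simp add: mat_inv_B_mat)
  then show ?thesis
    using assoc_mult_mat[OF I B, of ?R n] by (simp add: X_mat_def B_mat_times_reduced)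
qed

lemma X_mat_entry:
  "r < n \<Longrightarrow> s < n \<Longrightarrow> X_mat \<alpha> \<kappa> n $$ (r, s) = reduced_entry \<alpha> \<kappa> r s"
  by (simp add: X_mat_eq)

theorem theorem1:
  fixes \<alpha> \<kappa> :: real and n :: nat
  assumes "\<alpha> > -1" and "\<kappa> > -1" and "n \<ge> 1"
  shows "invertible_mat (B_mat n) \<and> invertible_mat (D_mat n) \<and>
    mat_inv (B_mat n) = mat_inv (D_mat n) * M_mat n \<and>
    X_mat \<alpha> \<kappa> n \<in> carrier_mat n n \<and>
    X_mat \<alpha> \<kappa> n $$ (0, 0) = (\<alpha> + 1) * (\<kappa> + 1) \<and>
    (n \<ge> 2 \<longrightarrow> X_mat \<alpha> \<kappa> n $$ (1, 0) = \<alpha> * \<kappa> / 2 - 1) \<and>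
    (\<forall>i\<in>{2..n - 1}. X_mat \<alpha> \<kappa> n $$ (i, 0) = \<alpha> * \<kappa> / (real i + 1)) \<and>
    (\<forall>i\<in>{2..n}. X_mat \<alpha> \<kappa> n $$ (i - 2, i - 1)
        = - ((real i - 1 + \<alpha>) * (real i - 1 + \<kappa>) / (real i - 1))) \<and>
    (\<forall>i\<in>{2..n}. X_mat \<alpha> \<kappa> n $$ (i - 1, i - 1) = 2 * real i - 1 + \<alpha> + \<kappa>) \<and>
    (\<forall>i\<in>{2..n - 1}. X_mat \<alpha> \<kappa> n $$ (i, i - 1) = - real i) \<and>
    (\<forall>i\<in>{1..n}. \<forall>j\<in>{2..n}. i \<noteq> j \<and> i + 1 \<noteq> j \<and> i \<noteq> j + 1
        \<longrightarrow> X_mat \<alpha> \<kappa> n $$ (i - 1, j - 1) = 0)"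
proof (intro conjI)
  show "invertible_mat (B_mat n)"
    by (rule invertible_mat_of_right_inverse[OF _ _ B_mat_right_inverse])
      (simp_all add: B_mat_def mat_inv_D_mat_times_M_mat)
  show "invertible_mat (D_mat n)"
    by (rule invertible_mat_of_right_inverse[OF _ _ D_mat_right_inverse]) (simp_all add: D_mat_def)
  show "mat_inv (B_mat n) = mat_inv (D_mat n) * M_mat n"
    by (rule mat_inv_B_mat)
  show "X_mat \<alpha> \<kappa> n \<in> carrier_mat n n"
    by (simp add: X_mat_eq)
qed (use assms in \<open>auto simp: X_mat_entry reduced_entry_def of_nat_diff, linarith+\<close>)

end
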